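(* Let $\mathcal{C}\subset\mathbb{R}^d$ be a nonempty compact convex set, let $f$ be a convex differentiable function on $\mathcal{C}$, and let $f_\star=\min_{x\in\mathcal{C}}f(x)$. For $x\in\mathcal{C}$ let $v(x)\in\operatorname{argmin}_{v\in\mathcal{C}}\langle\nabla f(x),v\rangle$ be the Frank-Wolfe corner and let $\delta(x)=v(x)-x$. Assume that $f$ is directionally smooth with direction function $\delta$ and constant $\mathcal{L}_{f,\delta}>0$. Let $x_0\in\mathcal{C}$ and let $(x_k)_{k\ge 0}$ be the iterates of the Frank-Wolfe algorithm $x_{k+1}=x_k+h_k\,\delta(x_k)$, where either the step size is $$h_k=h_{\mathrm{opt}}=\min\Big\{1,\frac{1}{\mathcal{L}_{f,\delta}}\Big\}\quad\text{for all }k,$$ or $h_k\in\operatorname{argmin}_{h\in[0,1]}f(x_k+h\,\delta(x_k))$ for all $k$ (line-search). Then for every $k\ge 1$ $$f(x_k)-f_\star\le\max\Big\{\frac12,\;1-\frac{1}{2\mathcal{L}_{f,\delta}}\Big\}\,\big(f(x_{k-1})-f_\star\big).$$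
   Context: A function $f$ is directionally smooth with direction function $\delta:\mathcal{C}\to\mathbb{R}^d$ and constant $\mathcal{L}_{f,\delta}>0$ if for all $x\in\mathcal{C}$ and all $h>0$ with $x+h\delta(x)\in\mathcal{C}$, $$f(x+h\delta(x))\le f(x)-h\langle-\nabla f(x),\delta(x)\rangle+\frac{\mathcal{L}_{f,\delta}h^2}{2}\langle-\nabla f(x),\delta(x)\rangle.$$ *)

theory Defs
  imports "HOL-Analysis.Analysis"
begin

(* The derivative is taken within C, so f need not be differentiable across the boundary
   of C, and C may have empty interior. In the latter case the gradient is determined only
   up to vectors orthogonal to the affine hull of C; any such choice g is allowed. *)
definition is_gradient_on ::
    "('a::euclidean_space \<Rightarrow> real) \<Rightarrow> ('a \<Rightarrow> 'a) \<Rightarrow> 'a set \<Rightarrow> bool" where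
  "is_gradient_on f g C \<longleftrightarrow>
     (\<forall>x\<in>C. (f has_derivative (\<lambda>d. g x \<bullet> d)) (at x within C))"

(* g is the gradient of f, \<delta> the direction function and L the constant. *)
definition directionally_smooth ::
    "'a::euclidean_space set \<Rightarrow> ('a \<Rightarrow> real) \<Rightarrow> ('a \<Rightarrow> 'a) \<Rightarrow> ('a \<Rightarrow> 'a) \<Rightarrow> real \<Rightarrow> bool" where
  "directionally_smooth C f g \<delta> L \<longleftrightarrow> L > 0 \<and>
     (\<forall>x\<in>C. \<forall>h>0. x + h *\<^sub>R \<delta> x \<in> C \<longrightarrow>
        f (x + h *\<^sub>R \<delta> x)
          \<le> f x - h * (- g x \<bullet> \<delta> x) + L * h\<^sup>2 / 2 * (- g x \<bullet> \<delta> x))"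

(* A selection v of the linear minimization oracle over C. *)
definition is_fw_corner ::
    "'a::euclidean_space set \<Rightarrow> ('a \<Rightarrow> 'a) \<Rightarrow> ('a \<Rightarrow> 'a) \<Rightarrow> bool" where
  "is_fw_corner C g v \<longleftrightarrow> (\<forall>x\<in>C. is_arg_min (\<lambda>w. g x \<bullet> w) (\<lambda>w. w \<in> C) (v x))"

end

theory Submission
  imports Defs
begin

text \<open>
  Write \<open>G = - g y \<bullet> \<delta> y\<close> for the Frank-Wolfe gap at a point \<open>y\<close> of \<open>C\<close>. Two inequalities
  give the linear rate.

  By convexity the gap dominates the suboptimality: the graph of \<open>f\<close> lies above its tangent at
  \<open>y\<close>, and the corner \<open>v y\<close> minimizes the linear part of that tangent over all of \<open>C\<close>, in
  particular against a minimizer of \<open>f\<close> (\<open>suboptimality_le_fw_gap\<close>).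

  In directional smoothness the quadratic term is also a multiple of \<open>G\<close>, not of
  \<open>\<parallel>\<delta> y\<parallel>\<^sup>2\<close>. The guaranteed decrease is therefore \<open>(h - L * h\<^sup>2 / 2) * G\<close>, and the short step
  \<open>h = min 1 (1 / L)\<close> makes it at least \<open>min (1 / 2) (1 / (2 * L)) * G\<close>
  (\<open>fw_short_step_decrease\<close>). An exact line search over \<open>[0, 1]\<close> decreases \<open>f\<close> at least as much,
  because the short step is one of its candidates.

  Combining the two, each step removes at least the fraction \<open>min (1 / 2) (1 / (2 * L))\<close> of the
  suboptimality.
\<close>

text \<open>
  The derivative is one-sided at boundary points of \<open>C\<close>, so the inequality is obtained along the
  segment from \<open>y\<close> to \<open>z\<close>: convexity bounds every forward difference quotient by
  \<open>f z - f y\<close>, and the quotients converge to the directional derivative.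
\<close>
lemma convex_on_above_tangent_within:
  fixes f :: "'a::real_normed_vector \<Rightarrow> real"
  assumes "convex_on C f" and deriv: "(f has_derivative D) (at y within C)"
    and "y \<in> C" "z \<in> C"
  shows "f y + D (z - y) \<le> f z"
proof -
  define p where "p t = y + t *\<^sub>R (z - y)" for t :: real
  have p_conv: "p t = (1 - t) *\<^sub>R y + t *\<^sub>R z" for t
    by (simp add: p_def algebra_simps)
  have "convex C"
    using assms(1) by (rule convex_on_imp_convex)
  then have p_in: "p t \<in> C" if "t \<in> {0..1}" for t
    using that \<open>y \<in> C\<close> \<open>z \<in> C\<close> by (auto simp: p_conv convex_alt)
  have "(p has_derivative (\<lambda>t. t *\<^sub>R (z - y))) (at 0 within {0..1})"
    unfolding p_def by (auto intro!: derivative_eq_intros)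
  moreover have "(f has_derivative D) (at (p 0) within p ` {0..1})"
    using deriv p_in by (auto simp: p_def[of 0] intro: has_derivative_subset)
  ultimately have "((\<lambda>t. f (p t)) has_derivative (\<lambda>t. D (t *\<^sub>R (z - y)))) (at 0 within {0..1})"
    using has_derivative_in_compose by blast
  moreover have "D (t *\<^sub>R (z - y)) = D (z - y) * t" for t
    using deriv by (simp add: has_derivative_bounded_linear bounded_linear.linear linear_cmul)
  ultimately have "((\<lambda>t. f (p t)) has_field_derivative D (z - y)) (at 0 within {0..1})"
    by (simp add: has_field_derivative_def)
  then have "((\<lambda>t. (f (p t) - f (p 0)) / (t - 0)) \<longlongrightarrow> D (z - y)) (at 0 within {0..1})"
    by (simp add: has_field_derivative_iff)
  moreover have "\<forall>\<^sub>F t in at 0 within {0..1}. (f (p t) - f (p 0)) / (t - 0) \<le> f z - f y"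
  proof -
    have "(f (p t) - f y) / t \<le> f z - f y" if "t \<in> {0..1}" "t \<noteq> 0" for t
    proof -
      have "f (p t) \<le> (1 - t) * f y + t * f z"
        using convex_onD[OF assms(1), of t y z] that \<open>y \<in> C\<close> \<open>z \<in> C\<close> by (simp add: p_conv)
      then show ?thesis
        using that by (simp add: field_simps)
    qed
    then show ?thesis
      by (auto simp: eventually_at_filter p_def[of 0])
  qed
  moreover have "at (0::real) within {0..1} \<noteq> bot"
    by (simp add: at_within_Icc_at_right trivial_limit_at_right_real)
  ultimately have "D (z - y) \<le> f z - f y"
    using tendsto_upperbound by blast
  then show ?thesis by simp
qed

lemma suboptimality_le_fw_gap:
  assumes "convex_on C f" "is_gradient_on f g C" "is_fw_corner C g v" "y \<in> C" "z \<in> C"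
  shows "f y - f z \<le> - g y \<bullet> (v y - y)"
proof -
  have "f y + g y \<bullet> (z - y) \<le> f z"
    using assms by (intro convex_on_above_tangent_within) (auto simp: is_gradient_on_def)
  moreover have "g y \<bullet> v y \<le> g y \<bullet> z"
    using assms by (auto simp: is_fw_corner_def is_arg_min_linorder)
  ultimately show ?thesis
    by (simp add: inner_diff_right)
qed

text \<open>
  The map \<open>h \<mapsto> h - L * h\<^sup>2 / 2\<close> is maximal on \<open>[0, 1]\<close> at \<open>min 1 (1 / L)\<close>. Its value there is
  \<open>1 - L / 2 \<ge> 1 / 2\<close> if \<open>L \<le> 1\<close>, and \<open>1 / (2 * L)\<close> otherwise.
\<close>
lemma short_step_coefficient:
  fixes L :: real
  assumes "L > 0"
  shows "min (1 / 2) (1 / (2 * L)) \<le> min 1 (1 / L) - L * (min 1 (1 / L))\<^sup>2 / 2"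
proof (cases "L \<le> 1")
  case True
  then have "min 1 (1 / L) = 1"
    using assms by (simp add: min_def field_simps)
  then show ?thesis
    using True by (simp add: min_def)
next
  case False
  then have "min 1 (1 / L) = 1 / L"
    by (simp add: min_def field_simps)
  moreover have "1 / L - L * (1 / L)\<^sup>2 / 2 = 1 / (2 * L)"
    using assms by (simp add: power2_eq_square field_simps)
  ultimately show ?thesis
    by simp
qed

lemma fw_short_step_decrease:
  fixes L :: real
  defines "s \<equiv> min 1 (1 / L)"
  assumes "directionally_smooth C f g \<delta> L" "y \<in> C" "y + s *\<^sub>R \<delta> y \<in> C"
    and gap: "0 \<le> - g y \<bullet> \<delta> y"
  shows "f (y + s *\<^sub>R \<delta> y) \<le> f y - min (1 / 2) (1 / (2 * L)) * (- g y \<bullet> \<delta> y)"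
proof -
  have "L > 0"
    using assms(2) by (simp add: directionally_smooth_def)
  then have "s > 0"
    by (simp add: s_def)
  then have "f (y + s *\<^sub>R \<delta> y) \<le> f y - s * (- g y \<bullet> \<delta> y) + L * s\<^sup>2 / 2 * (- g y \<bullet> \<delta> y)"
    using assms unfolding directionally_smooth_def by blast
  also have "\<dots> = f y - (s - L * s\<^sup>2 / 2) * (- g y \<bullet> \<delta> y)"
    by (simp add: algebra_simps)
  also have "\<dots> \<le> f y - min (1 / 2) (1 / (2 * L)) * (- g y \<bullet> \<delta> y)"
    using mult_right_mono[OF short_step_coefficient[OF \<open>L > 0\<close>] gap] by (simp add: s_def)
  finally show ?thesis .
qed

text \<open>
  On a nonempty compact set the infimum of the values is attained, so the \<open>LEAST\<close> operator on the
  reals denotes an actual value of \<open>f\<close>.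
\<close>
lemma compact_attains_Least:
  fixes f :: "'a::topological_space \<Rightarrow> real"
  assumes "compact C" "C \<noteq> {}" "continuous_on C f"
  obtains z where "z \<in> C" "(LEAST y. y \<in> f ` C) = f z" "\<And>y. y \<in> C \<Longrightarrow> f z \<le> f y"
proof -
  obtain z where z: "z \<in> C" "\<And>y. y \<in> C \<Longrightarrow> f z \<le> f y"
    using continuous_attains_inf[OF assms] by blast
  then have "(LEAST y. y \<in> f ` C) = f z"
    by (intro Least_equality) auto
  with z that show thesis by blast
qed

theorem theorem5p1:
  fixes C :: "(real ^ 'd) set"
    and f :: "real ^ 'd \<Rightarrow> real"
    and g v \<delta> :: "real ^ 'd \<Rightarrow> real ^ 'd"
    and L f_star :: real
    and x :: "nat \<Rightarrow> real ^ 'd"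
    and h :: "nat \<Rightarrow> real"
  assumes C: "C \<noteq> {}" "compact C" "convex C"
    and f_convex: "convex_on C f"
    and f_gradient: "is_gradient_on f g C"
    and f_star: "f_star = (LEAST y. y \<in> f ` C)"
    and corner: "is_fw_corner C g v"
    and \<delta>: "\<And>y. y \<in> C \<Longrightarrow> \<delta> y = v y - y"
    and smooth: "directionally_smooth C f g \<delta> L"
    and x0: "x 0 \<in> C"
    and iterates: "\<And>k. x (Suc k) = x k + h k *\<^sub>R \<delta> (x k)"
    and step_size:
      "(\<forall>k. h k = min 1 (1 / L)) \<or>
       (\<forall>k. is_arg_min (\<lambda>t. f (x k + t *\<^sub>R \<delta> (x k))) (\<lambda>t. t \<in> {0..1}) (h k))"
  shows "\<forall>k\<ge>1. f (x k) - f_star \<le> max (1 / 2) (1 - 1 / (2 * L)) * (f (x (k - 1)) - f_star)"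
proof -
  define s where "s = min 1 (1 / L)"
  define c where "c = min (1 / 2) (1 / (2 * L))"
  have "L > 0"
    using smooth by (simp add: directionally_smooth_def)
  then have s01: "s \<in> {0..1}"
    by (simp add: s_def)
  have "continuous_on C f"
    using f_gradient
    by (auto simp: is_gradient_on_def continuous_on_eq_continuous_within
        intro: has_derivative_continuous)
  then obtain z where z: "z \<in> C" "f_star = f z" "\<And>y. y \<in> C \<Longrightarrow> f z \<le> f y"
    using compact_attains_Least C f_star by metis
  have step_in: "y + t *\<^sub>R \<delta> y \<in> C" if "y \<in> C" "t \<in> {0..1}" for y t
  proof -
    have "v y \<in> C"
      using corner that by (simp add: is_fw_corner_def is_arg_min_def)
    moreover have "y + t *\<^sub>R \<delta> y = (1 - t) *\<^sub>R y + t *\<^sub>R v y"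
      using that by (simp add: \<delta> algebra_simps)
    ultimately show ?thesis
      using C(3) that by (auto simp: convex_alt)
  qed
  have h01: "h k \<in> {0..1}" for k
    using step_size s01 by (auto simp: s_def is_arg_min_def)
  have x_in: "x k \<in> C" for k
    by (induction k) (use x0 iterates step_in h01 in auto)
  have contraction: "f (x (Suc k)) - f_star \<le> (1 - c) * (f (x k) - f_star)" for k
  proof -
    define G where "G = - g (x k) \<bullet> \<delta> (x k)"
    have gap: "f (x k) - f_star \<le> G"
      using suboptimality_le_fw_gap[OF f_convex f_gradient corner x_in z(1)]
      by (simp add: G_def \<delta> x_in z(2))
    then have "0 \<le> G"
      using z(2,3) x_in[of k] by fastforce
    have "f (x (Suc k)) \<le> f (x k + s *\<^sub>R \<delta> (x k))"
      using step_size s01 by (auto simp: iterates s_def is_arg_min_linorder)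
    also have "\<dots> \<le> f (x k) - c * G"
      using fw_short_step_decrease[OF smooth x_in[of k]] step_in[OF x_in s01, of k] \<open>0 \<le> G\<close>
      by (simp add: s_def c_def G_def)
    also have "\<dots> \<le> f (x k) - c * (f (x k) - f_star)"
      using mult_left_mono[OF gap, of c] \<open>L > 0\<close> by (simp add: c_def)
    finally show ?thesis
      by (simp add: algebra_simps)
  qed
  have rate: "max (1 / 2) (1 - 1 / (2 * L)) = 1 - c"
    by (simp add: c_def max_def min_def)
  show ?thesis
  proof (intro allI impI)
    fix k :: nat
    assume "k \<ge> 1"
    then show "f (x k) - f_star \<le> max (1 / 2) (1 - 1 / (2 * L)) * (f (x (k - 1)) - f_star)"
      using contraction[of "k - 1"] by (simp add: rate)
  qed
qed

end
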